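(* Consider $I_1\times I_2$ probability tables and suppose that both the row logit type $l_1$ and the column logit type $l_2$ are different from $L$ (i.e. $l_1,l_2\in\{G,C,R\}$). Let row scores $\mu_{k,1},\dots,\mu_{k,I_1}$ and column scores $\nu_{k,1},\dots,\nu_{k,I_2}$, $k=1,\dots,K$, be given. Within the class of all possible bivariate distributions of $(X_1,X_2)$ on $\{1,\dots,I_1\}\times\{1,\dots,I_2\}$ having (i) the same set of marginals $q(i,j;u,+)=p(i,j;u,0)+p(i,j;u,1)$ and $q(i,j;+,v)=p(i,j;0,v)+p(i,j;1,v)$ relative to the event probabilities $p(i,j;u,v)$, (ii) the same set of row and column scores $\mu_{k,i+u}$, $\nu_{k,j+v}$, and (iii) the values of $$\rho_k=\sum_{i=1}^{I_1-1}\sum_{j=1}^{I_2-1}\sum_{u,v\in\{0,1\}}p(i,j;u,v)\,\mu_{k,i+u}\,\nu_{k,j+v},\qquad k=1,\dots,K,$$ fixed at $\rho_k^*$, for $i\in\{1,\dots,I_1-1\}$, $j\in\{1,\dots,I_2-1\}$, $u,v\in\{0,1\}$, the distribution closest to independence in terms of $$I_\psi=\sum_{i=1}^{I_1-1}\sum_{j=1}^{I_2-1}\sum_{u,v\in\{0,1\}} r(i,j;u,v)\,\phi\!\left(\frac{p(i,j;u,v)}{r(i,j;u,v)}\right),\qquad r(i,j;u,v)=p_1(i;u)\,p_2(j;v),$$ (that is, the one minimizing $I_\psi$) has the form $$p(i,j;u,v)=p_1(i;u)\,p_2(j;v)\,G\!\left[\alpha_{iju}+\beta_{ijv}+\sum_{k=1}^K\psi_k\,\mu_{k,i+u}\,\nu_{k,j+v}\right],$$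 where the function $G$ is the inverse of the function $F=\phi'$ and $\alpha_{iju},\beta_{ijv},\psi_k$ are real parameters.
   Context: $X_1$ (rows, categories $1,\dots,I_1$) and $X_2$ (columns, categories $1,\dots,I_2$) are categorical variables with a joint distribution on the $I_1\times I_2$ table. Each variable is assigned a logit type $l\in\{L,G,C,R\}$ (local, global, continuation, reverse continuation). For a variable with $I$ categories and a cut point $x\in\{1,\dots,I-1\}$ define the events $E(x,0,l)=\{x\}$ if $l\in\{L,C\}$ and $E(x,0,l)=\{1,\dots,x\}$ if $l\in\{G,R\}$; $E(x,1,l)=\{x+1\}$ if $l\in\{L,R\}$ and $E(x,1,l)=\{x+1,\dots,I\}$ if $l\in\{G,C\}$. For a given joint distribution of $(X_1,X_2)$, $p_1(i;u)=P(X_1\in E(i,u,l_1))$, $p_2(j;v)=P(X_2\in E(j,v,l_2))$, and $p(i,j;u,v)=P(X_1\in E(i,u,l_1),\,X_2\in E(j,v,l_2))$. $\phi$ is a real-valued convex function on $[0,\infty)$ with $\phi(1)=\phi'(1)=0$, $0\,\phi(0/0)=0$, $0\,\phi(y/0)=\lim_{x\to\infty}\phi(x)/x$; $F=\phi'$ is its first derivative, and the inverse $G=F^{-1}$ is assumed to exist everywhere.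
   Formalization: Adds that the closest distribution has all cells positive and, if a variable with more than two categories has type C or R, that it also minimizes I_psi over all nonnegative p(i,j;u,v) satisfying (i) and (iii), whether or not they come from a distribution; the claim fails without these. *)

theory Defs
  imports "HOL-Analysis.Analysis" "HOL-Probability.Probability"
begin

datatype logit = Local | Global | Continuation | Reverse_Continuation

text \<open>
  \<open>cut_event I l x u\<close> is the event $E(x,u,l)$ for a variable with categories \<open>1, \<dots>, I\<close>; it is
  only meant for \<open>x \<in> {1..I - 1}\<close> and \<open>u \<in> {0, 1}\<close>.
\<close>

definition cut_event :: "nat \<Rightarrow> logit \<Rightarrow> nat \<Rightarrow> nat \<Rightarrow> nat set" where
  "cut_event I l x u =
     (if u = 0
      then (if l \<in> {Local, Continuation} then {x} else {1..x})
      else (if l \<in> {Local, Reverse_Continuation} then {x + 1} else {x + 1..I}))"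

definition table :: "nat \<Rightarrow> nat \<Rightarrow> (nat \<times> nat) pmf set" where
  "table I1 I2 = {P. set_pmf P \<subseteq> {1..I1} \<times> {1..I2}}"

definition row_prob :: "nat \<Rightarrow> logit \<Rightarrow> (nat \<times> nat) pmf \<Rightarrow> nat \<Rightarrow> nat \<Rightarrow> real" where
  "row_prob I1 l1 P i u = measure_pmf.prob P {z. fst z \<in> cut_event I1 l1 i u}"

definition col_prob :: "nat \<Rightarrow> logit \<Rightarrow> (nat \<times> nat) pmf \<Rightarrow> nat \<Rightarrow> nat \<Rightarrow> real" where
  "col_prob I2 l2 P j v = measure_pmf.prob P {z. snd z \<in> cut_event I2 l2 j v}"

text \<open>A family \<open>a i j u v\<close> of $2 \times 2$ arrays indexed by the pairs of cut points.\<close>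

type_synonym system = "nat \<Rightarrow> nat \<Rightarrow> nat \<Rightarrow> nat \<Rightarrow> real"

definition event_prob ::
    "nat \<Rightarrow> nat \<Rightarrow> logit \<Rightarrow> logit \<Rightarrow> (nat \<times> nat) pmf \<Rightarrow> system" where
  "event_prob I1 I2 l1 l2 P i j u v =
     measure_pmf.prob P {z. fst z \<in> cut_event I1 l1 i u \<and> snd z \<in> cut_event I2 l2 j v}"

definition indep_prob ::
    "nat \<Rightarrow> nat \<Rightarrow> logit \<Rightarrow> logit \<Rightarrow> (nat \<times> nat) pmf \<Rightarrow> system" where
  "indep_prob I1 I2 l1 l2 P i j u v = row_prob I1 l1 P i u * col_prob I2 l2 P j v"

definition system_sum :: "nat \<Rightarrow> nat \<Rightarrow> system \<Rightarrow> real" where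
  "system_sum I1 I2 a =
     (\<Sum>i\<in>{1..I1 - 1}. \<Sum>j\<in>{1..I2 - 1}. \<Sum>u\<in>{0, 1}. \<Sum>v\<in>{0, 1}. a i j u v)"

definition rho ::
    "nat \<Rightarrow> nat \<Rightarrow> (nat \<Rightarrow> nat \<Rightarrow> real) \<Rightarrow> (nat \<Rightarrow> nat \<Rightarrow> real) \<Rightarrow> nat \<Rightarrow> system \<Rightarrow> real" where
  "rho I1 I2 \<mu> \<nu> k a =
     system_sum I1 I2 (\<lambda>i j u v. a i j u v * \<mu> k (i + u) * \<nu> k (j + v))"

text \<open>
  For the event probabilities of a distribution, \<open>r i j u v = 0\<close> forces \<open>a i j u v = 0\<close>. Hence only
  the convention $0\,\phi(0/0) = 0$ is ever used below, and it holds for the real multiplication.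
\<close>

definition divergence :: "nat \<Rightarrow> nat \<Rightarrow> (real \<Rightarrow> real) \<Rightarrow> system \<Rightarrow> system \<Rightarrow> real" where
  "divergence I1 I2 \<phi> r a =
     system_sum I1 I2 (\<lambda>i j u v. r i j u v * \<phi> (a i j u v / r i j u v))"

definition dist_divergence ::
    "nat \<Rightarrow> nat \<Rightarrow> logit \<Rightarrow> logit \<Rightarrow> (real \<Rightarrow> real) \<Rightarrow> (nat \<times> nat) pmf \<Rightarrow> real" where
  "dist_divergence I1 I2 l1 l2 \<phi> P =
     divergence I1 I2 \<phi> (indep_prob I1 I2 l1 l2 P) (event_prob I1 I2 l1 l2 P)"

text \<open>
  Nonnegative systems with prescribed marginals \<open>q1 i j u\<close> $= q(i,j;u,+)$, \<open>q2 i j v\<close>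
  $= q(i,j;+,v)$ and prescribed values of the \<open>K\<close> association measures. A member need not be the
  system of event probabilities of a distribution on the \<open>I1 \<times> I2\<close> table: for continuation
  logits with more than two categories the event probabilities at different pairs of cut points
  satisfy linear relations that the marginals do not imply.
\<close>

definition system_class ::
    "nat \<Rightarrow> nat \<Rightarrow> nat \<Rightarrow> (nat \<Rightarrow> nat \<Rightarrow> real) \<Rightarrow> (nat \<Rightarrow> nat \<Rightarrow> real) \<Rightarrow>
     (nat \<Rightarrow> nat \<Rightarrow> nat \<Rightarrow> real) \<Rightarrow> (nat \<Rightarrow> nat \<Rightarrow> nat \<Rightarrow> real) \<Rightarrow> (nat \<Rightarrow> real) \<Rightarrow> system set" where
  "system_class I1 I2 K \<mu> \<nu> q1 q2 \<rho>s =
     {a. (\<forall>i\<in>{1..I1 - 1}. \<forall>j\<in>{1..I2 - 1}.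
            (\<forall>u\<in>{0, 1}. \<forall>v\<in>{0, 1}. 0 \<le> a i j u v) \<and>
            (\<forall>u\<in>{0, 1}. a i j u 0 + a i j u 1 = q1 i j u) \<and>
            (\<forall>v\<in>{0, 1}. a i j 0 v + a i j 1 v = q2 i j v)) \<and>
         (\<forall>k\<in>{1..K}. rho I1 I2 \<mu> \<nu> k a = \<rho>s k)}"

definition table_class ::
    "nat \<Rightarrow> nat \<Rightarrow> logit \<Rightarrow> logit \<Rightarrow> nat \<Rightarrow> (nat \<Rightarrow> nat \<Rightarrow> real) \<Rightarrow> (nat \<Rightarrow> nat \<Rightarrow> real) \<Rightarrow>
     (nat \<Rightarrow> nat \<Rightarrow> nat \<Rightarrow> real) \<Rightarrow> (nat \<Rightarrow> nat \<Rightarrow> nat \<Rightarrow> real) \<Rightarrow> (nat \<Rightarrow> real) \<Rightarrow>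
     (nat \<times> nat) pmf set" where
  "table_class I1 I2 l1 l2 K \<mu> \<nu> q1 q2 \<rho>s =
     {P \<in> table I1 I2. event_prob I1 I2 l1 l2 P \<in> system_class I1 I2 K \<mu> \<nu> q1 q2 \<rho>s}"

end

theory Submission
  imports Defs
begin

text \<open>
  Moving the mass \<open>t * \<delta> (i, j)\<close> with alternating signs through the four cells of each array keeps
  its marginals, and keeps every \<open>\<rho>\<^sub>k\<close> if \<open>\<delta>\<close> is orthogonal to the interactions of the score products.
  Stationarity of the divergence then says that the interactions of \<open>F (p / r)\<close> are orthogonal to
  all such \<open>\<delta>\<close>, hence a combination of the score interactions with weights \<open>\<psi>\<^sub>k\<close>; the remainder has
  no interaction and splits as \<open>\<alpha> + \<beta>\<close>. For global logits (and for two categories, where all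
  types agree) the moved system is realised by a table, namely by adding \<open>t * \<delta>\<close> to the joint
  distribution function, which leaves the independence system unchanged.
\<close>

section \<open>Orthogonal complements in finite dimension\<close>

text \<open>Double annihilator argument, the source of the multipliers \<psi>. By induction on
  \<open>N\<close>: either orthogonality to \<open>c k\<close> already follows from orthogonality to
  the others, or some \<open>v\<close> orthogonal to the others detects \<open>c k\<close>, and a
  multiple of \<open>c k\<close> can be split off from \<open>g\<close>.\<close>

lemma mem_span_of_orthogonal_complement:
  fixes c :: "'k \<Rightarrow> 'a \<Rightarrow> real" and g :: "'a \<Rightarrow> real"
  assumes "finite N"
    and "\<And>\<delta>. (\<And>k. k \<in> N \<Longrightarrow> (\<Sum>s\<in>S. \<delta> s * c k s) = 0) \<Longrightarrow> (\<Sum>s\<in>S. \<delta> s * g s) = 0"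
    and "finite S"
  shows "\<exists>\<psi>. \<forall>s\<in>S. g s = (\<Sum>k\<in>N. \<psi> k * c k s)"
  using assms(1,2)
proof (induction N arbitrary: g rule: finite_induct)
  case empty
  \<comment> \<open>Without constraints, \<open>g\<close> itself is an admissible direction.\<close>
  have "(\<Sum>s\<in>S. g s * g s) = 0" by (rule empty) auto
  with \<open>finite S\<close> have "\<forall>s\<in>S. g s * g s = 0"
    by (subst (asm) sum_nonneg_eq_0_iff) auto
  then show ?case by simp
next
  case (insert k N)
  show ?case
  proof (cases "\<forall>\<delta>. (\<forall>k'\<in>N. (\<Sum>s\<in>S. \<delta> s * c k' s) = 0) \<longrightarrow> (\<Sum>s\<in>S. \<delta> s * c k s) = 0")
    case True
    \<comment> \<open>The constraint from \<open>c k\<close> is redundant here, so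
      \<open>c k\<close> gets weight 0.\<close>
    have "\<exists>\<psi>. \<forall>s\<in>S. g s = (\<Sum>k\<in>N. \<psi> k * c k s)"
      by (rule insert.IH, rule insert.prems) (use True in auto)
    then obtain \<psi> where \<psi>: "\<forall>s\<in>S. g s = (\<Sum>k\<in>N. \<psi> k * c k s)" by blast
    have "(\<Sum>k'\<in>N. (\<psi>(k := 0)) k' * c k' s) = (\<Sum>k'\<in>N. \<psi> k' * c k' s)" for s
      using insert.hyps by (intro sum.cong) auto
    with \<psi> insert.hyps show ?thesis
      by (intro exI[of _ "\<psi>(k := 0)"]) simp
  next
    case False
    then obtain v where v: "\<forall>k'\<in>N. (\<Sum>s\<in>S. v s * c k' s) = 0"
      and vk: "(\<Sum>s\<in>S. v s * c k s) \<noteq> 0" by blast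
    \<comment> \<open>The only possible weight of \<open>c k\<close>: pairing a representation of
      \<open>g\<close> with \<open>v\<close> kills all other terms.\<close>
    define m where "m = (\<Sum>s\<in>S. v s * g s) / (\<Sum>s\<in>S. v s * c k s)"
    have "\<exists>\<psi>. \<forall>s\<in>S. g s - m * c k s = (\<Sum>k\<in>N. \<psi> k * c k s)"
    proof (rule insert.IH)
      fix \<delta> assume \<delta>: "\<And>k'. k' \<in> N \<Longrightarrow> (\<Sum>s\<in>S. \<delta> s * c k' s) = 0"
      \<comment> \<open>Chosen so that \<open>\<delta> - e * v\<close> becomes orthogonal to
        \<open>c k\<close> as well, while it stays orthogonal to the others.\<close>
      define e where "e = (\<Sum>s\<in>S. \<delta> s * c k s) / (\<Sum>s\<in>S. v s * c k s)"
      have expand: "(\<Sum>s\<in>S. (\<delta> s - e * v s) * f s) = (\<Sum>s\<in>S. \<delta> s * f s) - e * (\<Sum>s\<in>S. v s * f s)"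
        for f by (simp add: left_diff_distrib sum_subtractf sum_distrib_left mult.assoc)
      have "(\<Sum>s\<in>S. (\<delta> s - e * v s) * g s) = 0"
      proof (rule insert.prems)
        fix k' assume "k' \<in> insert k N"
        then show "(\<Sum>s\<in>S. (\<delta> s - e * v s) * c k' s) = 0"
          unfolding expand using \<delta> v vk by (auto simp: e_def)
      qed
      then have "(\<Sum>s\<in>S. \<delta> s * g s) = m * (\<Sum>s\<in>S. \<delta> s * c k s)"
        unfolding expand by (simp add: e_def m_def)
      then show "(\<Sum>s\<in>S. \<delta> s * (g s - m * c k s)) = 0"
        by (simp add: right_diff_distrib sum_subtractf sum_distrib_left mult.left_commute)
    qed
    then obtain \<psi> where \<psi>: "\<forall>s\<in>S. g s - m * c k s = (\<Sum>k\<in>N. \<psi> k * c k s)" by blast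
    have "(\<Sum>k'\<in>N. (\<psi>(k := m)) k' * c k' s) = (\<Sum>k'\<in>N. \<psi> k' * c k' s)" for s
      using insert.hyps by (intro sum.cong) auto
    with \<psi> insert.hyps show ?thesis
      by (intro exI[of _ "\<psi>(k := m)"]) (auto simp: algebra_simps)
  qed
qed

section \<open>Interactions and marginal-preserving shifts\<close>

text \<open>The mixed second difference of a 2 x 2 array. It vanishes exactly on arrays that are a
  function of \<open>u\<close> plus a function of \<open>v\<close>, the shape that \<alpha> and
  \<beta> can absorb.\<close>

definition interaction :: "system \<Rightarrow> nat \<times> nat \<Rightarrow> real" where
  "interaction w = (\<lambda>(i, j). w i j 0 0 - w i j 0 1 - w i j 1 0 + w i j 1 1)"

text \<open>The alternating sign pattern spans the 2 x 2 arrays with zero row and column sums. These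
  shifts are therefore all the linear moves that fix the marginals at every pair of cut
  points.\<close>

definition shifted_system :: "system \<Rightarrow> (nat \<times> nat \<Rightarrow> real) \<Rightarrow> real \<Rightarrow> system" where
  "shifted_system a \<delta> t = (\<lambda>i j u v. a i j u v + t * ((- 1) ^ (u + v) * \<delta> (i, j)))"

lemma system_sum_cong:
  assumes "\<And>i j u v. i \<in> {1..I1 - 1} \<Longrightarrow> j \<in> {1..I2 - 1} \<Longrightarrow> u \<in> {0, 1} \<Longrightarrow> v \<in> {0, 1} \<Longrightarrow>
    a i j u v = b i j u v"
  shows "system_sum I1 I2 a = system_sum I1 I2 b"
  unfolding system_sum_def by (intro sum.cong refl assms)

text \<open>The signs collapse the four cells into one interaction. Both the constraints and the
  gradient thus become pairings with \<open>\<delta>\<close> over the cut points.\<close>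

lemma system_sum_alternating:
  "system_sum I1 I2 (\<lambda>i j u v. (- 1) ^ (u + v) * \<delta> (i, j) * w i j u v) =
     (\<Sum>z\<in>{1..I1 - 1} \<times> {1..I2 - 1}. \<delta> z * interaction w z)"
  unfolding system_sum_def interaction_def
  by (simp add: sum.cartesian_product' algebra_simps)

lemma system_sum_add_mult:
  "system_sum I1 I2 (\<lambda>i j u v. a i j u v + t * b i j u v) = system_sum I1 I2 a + t * system_sum I1 I2 b"
  by (simp only: system_sum_def sum.distrib sum_distrib_left)

lemma rho_shifted_system:
  "rho I1 I2 \<mu> \<nu> k (shifted_system a \<delta> t) = rho I1 I2 \<mu> \<nu> k a +
     t * (\<Sum>z\<in>{1..I1 - 1} \<times> {1..I2 - 1}. \<delta> z * interaction (\<lambda>i j u v. \<mu> k (i + u) * \<nu> k (j + v)) z)"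
  unfolding rho_def system_sum_alternating[symmetric] system_sum_add_mult[symmetric]
  by (rule system_sum_cong) (simp add: shifted_system_def algebra_simps)

lemma system_class_cong:
  assumes "\<And>i j u v. i \<in> {1..I1 - 1} \<Longrightarrow> j \<in> {1..I2 - 1} \<Longrightarrow> u \<in> {0, 1} \<Longrightarrow> v \<in> {0, 1} \<Longrightarrow>
    a i j u v = b i j u v"
  shows "a \<in> system_class I1 I2 K \<mu> \<nu> q1 q2 \<rho>s \<longleftrightarrow> b \<in> system_class I1 I2 K \<mu> \<nu> q1 q2 \<rho>s"
proof -
  have "rho I1 I2 \<mu> \<nu> k a = rho I1 I2 \<mu> \<nu> k b" for k
    unfolding rho_def by (intro system_sum_cong) (simp add: assms)
  then show ?thesis unfolding system_class_def using assms by simp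
qed

lemma shifted_system_in_class:
  assumes a: "a \<in> system_class I1 I2 K \<mu> \<nu> q1 q2 \<rho>s"
    and pos: "\<And>i j u v. i \<in> {1..I1 - 1} \<Longrightarrow> j \<in> {1..I2 - 1} \<Longrightarrow> u \<in> {0, 1} \<Longrightarrow> v \<in> {0, 1} \<Longrightarrow>
      0 \<le> shifted_system a \<delta> t i j u v"
    and orth: "\<And>k. k \<in> {1..K} \<Longrightarrow>
      (\<Sum>z\<in>{1..I1 - 1} \<times> {1..I2 - 1}. \<delta> z * interaction (\<lambda>i j u v. \<mu> k (i + u) * \<nu> k (j + v)) z) = 0"
  shows "shifted_system a \<delta> t \<in> system_class I1 I2 K \<mu> \<nu> q1 q2 \<rho>s"
proof -
  have "rho I1 I2 \<mu> \<nu> k (shifted_system a \<delta> t) = \<rho>s k" if "k \<in> {1..K}" for k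
    using a that orth[OF that] by (simp add: rho_shifted_system system_class_def)
  moreover have "shifted_system a \<delta> t i j u 0 + shifted_system a \<delta> t i j u 1 = a i j u 0 + a i j u 1"
    "shifted_system a \<delta> t i j 0 v + shifted_system a \<delta> t i j 1 v = a i j 0 v + a i j 1 v" for i j u v
    by (simp_all add: shifted_system_def)
  ultimately show ?thesis
    using a pos unfolding system_class_def by simp
qed

text \<open>The factor \<open>r\<close> cancels the \<open>1 / r\<close> of the chain rule, so the
  gradient carries no weights. The reference \<open>r\<close> stays fixed along the shift, and
  positivity keeps the quotient where \<phi> is differentiable.\<close>

lemma divergence_shifted_system_deriv:
  assumes pos: "\<And>i j u v. i \<in> {1..I1 - 1} \<Longrightarrow> j \<in> {1..I2 - 1} \<Longrightarrow> u \<in> {0, 1} \<Longrightarrow> v \<in> {0, 1} \<Longrightarrow>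
      0 < a i j u v \<and> 0 < r i j u v"
    and F_deriv: "\<And>x. 0 < x \<Longrightarrow> (\<phi> has_real_derivative F x) (at x)"
  shows "((\<lambda>t. divergence I1 I2 \<phi> r (shifted_system a \<delta> t)) has_real_derivative
    (\<Sum>z\<in>{1..I1 - 1} \<times> {1..I2 - 1}. \<delta> z * interaction (\<lambda>i j u v. F (a i j u v / r i j u v)) z)) (at 0)"
  unfolding system_sum_alternating[symmetric]
  unfolding divergence_def system_sum_def
proof (intro DERIV_sum)
  fix i j u v assume ij: "i \<in> {1..I1 - 1}" "j \<in> {1..I2 - 1}" "u \<in> {0, 1::nat}" "v \<in> {0, 1::nat}"
  note p = pos[OF ij]
  have inner: "((\<lambda>t. shifted_system a \<delta> t i j u v / r i j u v) has_real_derivative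
      (- 1) ^ (u + v) * \<delta> (i, j) / r i j u v) (at 0)"
    unfolding shifted_system_def by (rule DERIV_cdivide) (auto intro!: derivative_eq_intros)
  have "(\<phi> has_real_derivative F (a i j u v / r i j u v)) (at (shifted_system a \<delta> 0 i j u v / r i j u v))"
    using F_deriv[of "a i j u v / r i j u v"] p by (simp add: shifted_system_def)
  from DERIV_cmult[OF DERIV_chain2[OF this inner], of "r i j u v"] p
  show "((\<lambda>t. r i j u v * \<phi> (shifted_system a \<delta> t i j u v / r i j u v)) has_real_derivative
      (- 1) ^ (u + v) * \<delta> (i, j) * F (a i j u v / r i j u v)) (at 0)"
    by (simp add: mult.commute)
qed

lemma eventually_nonneg_perturbation:
  fixes a :: "'a \<Rightarrow> real"
  assumes "finite A" "\<And>x. x \<in> A \<Longrightarrow> 0 < a x"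
  shows "\<forall>\<^sub>F t in nhds 0. \<forall>x\<in>A. 0 \<le> a x + t * b x"
proof (rule eventually_ball_finite[OF assms(1)], rule ballI)
  fix x assume "x \<in> A"
  have "((\<lambda>t. a x + t * b x) \<longlongrightarrow> a x + 0 * b x) (nhds 0)"
    by (intro tendsto_intros filterlim_ident)
  then have "\<forall>\<^sub>F t in nhds 0. 0 < a x + t * b x"
    using assms(2)[OF \<open>x \<in> A\<close>] by (intro order_tendstoD) auto
  then show "\<forall>\<^sub>F t in nhds 0. 0 \<le> a x + t * b x"
    by (rule eventually_mono) simp
qed

section \<open>Cut events and telescoping sums\<close>

lemma finite_cut_event [simp]: "finite (cut_event I l x u)"
  by (simp add: cut_event_def)

lemma cut_event_subset:
  assumes "x \<in> {1..I - 1}" shows "cut_event I l x u \<subseteq> {1..I}"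
  using assms by (auto simp: cut_event_def)

lemma cut_event_nonempty:
  assumes "x \<in> {1..I - 1}" shows "cut_event I l x u \<noteq> {}"
  using assms by (auto simp: cut_event_def)

text \<open>With two categories the only cut point is 1 and both events are singletons for every
  type.\<close>

lemma cut_event_eq_Global:
  assumes "l = Global \<or> \<not> I > 2" "x \<in> {1..I - 1}" "u \<in> {0, 1}"
  shows "cut_event I l x u = cut_event I Global x u"
proof (cases "l = Global")
  case False
  with assms have "I = 2" "x = 1" by auto
  then show ?thesis by (auto simp: cut_event_def)
qed simp

lemma sum_increments:
  fixes g :: "nat \<Rightarrow> real"
  assumes "m \<le> n"
  shows "(\<Sum>x\<in>{m + 1..n}. g x - g (x - 1)) = g n - g m"
  using assms by (induction n rule: dec_induct) auto

text \<open>The increments telescope to \<open>g x - g 0\<close> below the cut and to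
  \<open>g I - g x\<close> above it; the zero boundary values leave the alternating sign.\<close>

lemma sum_increments_cut_event:
  fixes g :: "nat \<Rightarrow> real"
  assumes "g 0 = 0" "g I = 0" "x \<in> {1..I - 1}" "u \<in> {0, 1}"
  shows "(\<Sum>y\<in>cut_event I Global x u. g y - g (y - 1)) = (- 1) ^ u * g x"
  using sum_increments[of 0 x g] sum_increments[of x I g] assms
  by (auto simp: cut_event_def)

text \<open>Regrouping that lets mixed differences telescope one coordinate at a time.\<close>

lemma sum_mixed_increments:
  fixes h :: "nat \<Rightarrow> nat \<Rightarrow> real"
  shows "(\<Sum>x\<in>A. \<Sum>y\<in>B. h x y - h (x - 1) y - h x (y - 1) + h (x - 1) (y - 1)) =
    (\<Sum>x\<in>A. (\<Sum>y\<in>B. h x y - h x (y - 1)) - (\<Sum>y\<in>B. h (x - 1) y - h (x - 1) (y - 1)))"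
  unfolding sum_subtractf[symmetric] by (intro sum.cong refl) simp

section \<open>Event probabilities as sums over the table\<close>

lemma prob_rectangle:
  assumes "finite A" "finite B"
  shows "measure_pmf.prob P {z. fst z \<in> A \<and> snd z \<in> B} = (\<Sum>x\<in>A. \<Sum>y\<in>B. pmf P (x, y))"
proof -
  have "{z. fst z \<in> A \<and> snd z \<in> B} = A \<times> B" by auto
  with assms show ?thesis
    by (simp add: measure_measure_pmf_finite sum.cartesian_product)
qed

lemma prob_rectangle_pos:
  assumes "A \<noteq> {}" "B \<noteq> {}" "A \<subseteq> {1..I1}" "B \<subseteq> {1..I2}"
    and "\<And>x y. x \<in> {1..I1} \<Longrightarrow> y \<in> {1..I2} \<Longrightarrow> 0 < pmf P (x, y)"
  shows "0 < measure_pmf.prob P {z. fst z \<in> A \<and> snd z \<in> B}"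
proof -
  obtain x y where xy: "x \<in> A" "y \<in> B" using assms(1,2) by auto
  have "0 < pmf P (x, y)" using assms xy by blast
  also have "\<dots> = measure_pmf.prob P {(x, y)}" by (simp add: measure_pmf_single)
  also have "\<dots> \<le> measure_pmf.prob P {z. fst z \<in> A \<and> snd z \<in> B}"
    using xy by (intro measure_pmf.finite_measure_mono) auto
  finally show ?thesis .
qed

text \<open>The support lies in the table, so a row event is a rectangle up to a null set. This
  exposes complete rows, over which a perturbation can be seen to cancel.\<close>

lemma row_prob_table:
  assumes "P \<in> table I1 I2"
  shows "row_prob I1 l P i u = (\<Sum>x\<in>cut_event I1 l i u. \<Sum>y\<in>{1..I2}. pmf P (x, y))"
proof -
  have "row_prob I1 l P i u = measure_pmf.prob P {z. fst z \<in> cut_event I1 l i u \<and> snd z \<in> {1..I2}}"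
    unfolding row_prob_def
    using assms by (intro measure_prob_cong_0) (auto simp: table_def set_pmf_iff)
  then show ?thesis by (simp only: prob_rectangle finite_atLeastAtMost finite_cut_event)
qed

lemma col_prob_table:
  assumes "P \<in> table I1 I2"
  shows "col_prob I2 l P j v = (\<Sum>x\<in>{1..I1}. \<Sum>y\<in>cut_event I2 l j v. pmf P (x, y))"
proof -
  have "col_prob I2 l P j v = measure_pmf.prob P {z. fst z \<in> {1..I1} \<and> snd z \<in> cut_event I2 l j v}"
    unfolding col_prob_def
    using assms by (intro measure_prob_cong_0) (auto simp: table_def set_pmf_iff)
  then show ?thesis by (simp only: prob_rectangle finite_atLeastAtMost finite_cut_event)
qed

lemma table_sum_pmf:
  assumes "P \<in> table I1 I2"
  shows "(\<Sum>z\<in>{1..I1} \<times> {1..I2}. pmf P z) = 1"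
  using assms by (intro sum_pmf_eq_1) (auto simp: table_def)

lemma table_with_pmf:
  assumes "\<And>z. z \<in> {1..I1} \<times> {1..I2} \<Longrightarrow> 0 \<le> f z"
    and "(\<Sum>z\<in>{1..I1} \<times> {1..I2}. f z) = 1"
  obtains Q where "Q \<in> table I1 I2" "\<And>z. z \<in> {1..I1} \<times> {1..I2} \<Longrightarrow> pmf Q z = f z"
proof -
  let ?S = "{1..I1} \<times> {1..I2}"
  \<comment> \<open>Extension by zero confines the support to the table.\<close>
  define g where "g z = (if z \<in> ?S then f z else 0)" for z
  have g: "0 \<le> g z" for z using assms(1) by (simp add: g_def)
  have "(\<integral>\<^sup>+z. ennreal (g z) \<partial>count_space UNIV) = (\<Sum>z\<in>?S. ennreal (g z))"
    by (rule nn_integral_count_space') (auto simp: g_def)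
  also have "\<dots> = ennreal (\<Sum>z\<in>?S. g z)" by (rule sum_ennreal) (rule g)
  also have "(\<Sum>z\<in>?S. g z) = 1" using assms(2) by (simp add: g_def)
  finally have "pmf (embed_pmf g) z = g z" for z
    by (intro pmf_embed_pmf g) simp
  then show ?thesis
    by (intro that[of "embed_pmf g"]) (auto simp: table_def set_pmf_iff g_def split: if_splits)
qed

section \<open>Realising a shift by a distribution on the table\<close>

text \<open>Under \<open>l1\<close> and \<open>l2\<close> all events are initial or final segments.
  Perturbing the masses by mixed differences of \<open>\<delta>\<close> therefore telescopes to the
  value of \<open>\<delta>\<close> at the cut points alone, with the right sign.\<close>

lemma shifted_table_exists:
  assumes P: "P \<in> table I1 I2"
    and supp: "{1..I1} \<times> {1..I2} \<subseteq> set_pmf P"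
    and l1: "l1 = Global \<or> \<not> I1 > 2" and l2: "l2 = Global \<or> \<not> I2 > 2"
  shows "\<forall>\<^sub>F t in nhds 0. \<exists>Q\<in>table I1 I2.
    \<forall>i\<in>{1..I1 - 1}. \<forall>j\<in>{1..I2 - 1}. \<forall>u\<in>{0, 1}. \<forall>v\<in>{0, 1}.
      event_prob I1 I2 l1 l2 Q i j u v = shifted_system (event_prob I1 I2 l1 l2 P) \<delta> t i j u v \<and>
      indep_prob I1 I2 l1 l2 Q i j u v = indep_prob I1 I2 l1 l2 P i j u v"
proof -
  \<comment> \<open>\<open>h\<close> is the change of the joint distribution function per unit of
    \<open>t\<close>, and \<open>D\<close> the corresponding change of the cell masses. The zero
    values at \<open>0\<close>, \<open>I1\<close> and \<open>I2\<close> supply the telescoping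
    boundaries and fix the row and column totals.\<close>
  define h where "h x y = (if x \<in> {1..I1 - 1} \<and> y \<in> {1..I2 - 1} then \<delta> (x, y) else 0)" for x y
  define D where "D x y = h x y - h (x - 1) y - h x (y - 1) + h (x - 1) (y - 1)" for x y
  have h0: "h 0 y = 0" "h x 0 = 0" for x y by (simp_all add: h_def)
  have hI: "h I1 y = 0" "h x I2 = 0" for x y by (auto simp: h_def)
  have D_event: "(\<Sum>x\<in>cut_event I1 l1 i u. \<Sum>y\<in>cut_event I2 l2 j v. D x y) =
      (- 1) ^ (u + v) * \<delta> (i, j)"
    if "i \<in> {1..I1 - 1}" "j \<in> {1..I2 - 1}" "u \<in> {0, 1}" "v \<in> {0, 1}" for i j u v
  proof -
    have inner: "(\<Sum>y\<in>cut_event I2 Global j v. h x y - h x (y - 1)) = (- 1) ^ v * h x j" for x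
      using that by (intro sum_increments_cut_event) (auto simp: h0 hI)
    have "(\<Sum>x\<in>cut_event I1 l1 i u. \<Sum>y\<in>cut_event I2 l2 j v. D x y) =
        (\<Sum>x\<in>cut_event I1 Global i u. (- 1) ^ v * h x j - (- 1) ^ v * h (x - 1) j)"
      unfolding D_def sum_mixed_increments cut_event_eq_Global[OF l1 that(1,3)]
        cut_event_eq_Global[OF l2 that(2,4)] inner ..
    also have "\<dots> = (- 1) ^ u * ((- 1) ^ v * h i j)"
      using that by (intro sum_increments_cut_event) (auto simp: h0 hI)
    finally show ?thesis using that by (simp add: h_def power_add)
  qed
  have D_row: "(\<Sum>y\<in>{1..I2}. D x y) = 0" for x
  proof -
    \<comment> \<open>Row \<open>x\<close> of \<open>D\<close> is the difference of two such
      telescoping rows, for \<open>x\<close> and \<open>x - 1\<close>.\<close>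
    have "(\<Sum>y\<in>{0 + 1..I2}. h x' y - h x' (y - 1)) = 0" for x'
      using sum_increments[of 0 I2 "h x'"] by (simp add: h0 hI)
    then show ?thesis
      using sum_mixed_increments[where h = h and A = "{x}" and B = "{1..I2}"] by (simp add: D_def)
  qed
  have D_col: "(\<Sum>x\<in>{1..I1}. \<Sum>y\<in>B. D x y) = 0" for B
  proof -
    have "(\<Sum>x\<in>{0 + 1..I1}. D x y) = 0" for y
      using sum_increments[of 0 I1 "\<lambda>x. h x y - h x (y - 1)"]
      by (simp add: D_def h0 hI algebra_simps)
    then show ?thesis by (subst sum.swap) simp
  qed
  \<comment> \<open>Full support leaves room to move in both directions.\<close>
  have "\<forall>\<^sub>F t in nhds 0. \<forall>z\<in>{1..I1} \<times> {1..I2}. 0 \<le> pmf P z + t * case_prod D z"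
    by (rule eventually_nonneg_perturbation) (use supp in \<open>auto intro!: pmf_positive\<close>)
  then show ?thesis
  proof (rule eventually_mono)
    fix t assume nonneg: "\<forall>z\<in>{1..I1} \<times> {1..I2}. 0 \<le> pmf P z + t * case_prod D z"
    have "(\<Sum>z\<in>{1..I1} \<times> {1..I2}. pmf P z + t * case_prod D z) = 1"
      using D_col[of "{1..I2}"] table_sum_pmf[OF P]
      by (simp add: sum.distrib sum_distrib_left[symmetric] sum.cartesian_product)
    with nonneg obtain Q where Q: "Q \<in> table I1 I2"
      and "\<And>z. z \<in> {1..I1} \<times> {1..I2} \<Longrightarrow> pmf Q z = pmf P z + t * case_prod D z"
      by (elim table_with_pmf[rotated]) auto
    then have sum_Q: "(\<Sum>x\<in>A. \<Sum>y\<in>B. pmf Q (x, y)) =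
        (\<Sum>x\<in>A. \<Sum>y\<in>B. pmf P (x, y)) + t * (\<Sum>x\<in>A. \<Sum>y\<in>B. D x y)"
      if "A \<subseteq> {1..I1}" "B \<subseteq> {1..I2}" for A B
      unfolding sum_distrib_left sum.distrib[symmetric] using that
      by (intro sum.cong refl) auto
    show "\<exists>Q\<in>table I1 I2. \<forall>i\<in>{1..I1 - 1}. \<forall>j\<in>{1..I2 - 1}. \<forall>u\<in>{0, 1}. \<forall>v\<in>{0, 1}.
        event_prob I1 I2 l1 l2 Q i j u v = shifted_system (event_prob I1 I2 l1 l2 P) \<delta> t i j u v \<and>
        indep_prob I1 I2 l1 l2 Q i j u v = indep_prob I1 I2 l1 l2 P i j u v"
    proof (intro bexI[OF _ Q] ballI conjI)
      fix i j u v :: nat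
      assume ij: "i \<in> {1..I1 - 1}" "j \<in> {1..I2 - 1}" "u \<in> {0, 1}" "v \<in> {0, 1}"
      note sub = cut_event_subset[OF ij(1), of l1 u] cut_event_subset[OF ij(2), of l2 v]
      show "event_prob I1 I2 l1 l2 Q i j u v = shifted_system (event_prob I1 I2 l1 l2 P) \<delta> t i j u v"
        by (simp add: event_prob_def shifted_system_def prob_rectangle sum_Q[OF sub] D_event[OF ij])
      \<comment> \<open>Row probabilities add \<open>D\<close> over complete rows and column
        probabilities over complete columns; both changes vanish.\<close>
      show "indep_prob I1 I2 l1 l2 Q i j u v = indep_prob I1 I2 l1 l2 P i j u v"
        unfolding indep_prob_def row_prob_table[OF Q] row_prob_table[OF P]
          col_prob_table[OF Q] col_prob_table[OF P]
          sum_Q[OF sub(1) subset_refl] sum_Q[OF subset_refl sub(2)] D_row D_col by simp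
    qed
  qed
qed

section \<open>Stationarity and the form of the closest distribution\<close>

text \<open>For a non-global type with more than two categories a shift of the event probabilities
  need not come from a table, so minimality among tables does not control it.
  \<open>coherence_not_binding\<close> supplies the inequality there, with the independence system
  of \<open>P\<close> as fixed reference. The inverse G is \<open>the_inv_into {0<..} F\<close>, and
  the conclusion includes that its argument lies in the range of \<open>F\<close>.\<close>

theorem theorem1:
  fixes I1 I2 K :: nat and l1 l2 :: logit
    and \<mu> \<nu> :: "nat \<Rightarrow> nat \<Rightarrow> real"
    and q1 q2 :: "nat \<Rightarrow> nat \<Rightarrow> nat \<Rightarrow> real" and \<rho>s :: "nat \<Rightarrow> real"
    and \<phi> F :: "real \<Rightarrow> real"
    and P :: "(nat \<times> nat) pmf"
  assumes logit_types: "l1 \<noteq> Local" "l2 \<noteq> Local"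
    and convex: "convex_on {0..} \<phi>"
    and F_deriv: "\<And>x. 0 < x \<Longrightarrow> (\<phi> has_real_derivative F x) (at x)"
    and normalised: "\<phi> 1 = 0" "F 1 = 0"
    and F_inj: "inj_on F {0<..}"
    and P_class: "P \<in> table_class I1 I2 l1 l2 K \<mu> \<nu> q1 q2 \<rho>s"
    and P_closest: "\<And>Q. Q \<in> table_class I1 I2 l1 l2 K \<mu> \<nu> q1 q2 \<rho>s \<Longrightarrow>
           dist_divergence I1 I2 l1 l2 \<phi> P \<le> dist_divergence I1 I2 l1 l2 \<phi> Q"
    and P_positive: "\<And>x y. x \<in> {1..I1} \<Longrightarrow> y \<in> {1..I2} \<Longrightarrow> 0 < pmf P (x, y)"
    and coherence_not_binding:
          "(l1 \<noteq> Global \<and> I1 > 2) \<or> (l2 \<noteq> Global \<and> I2 > 2) \<Longrightarrow>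
           \<forall>a \<in> system_class I1 I2 K \<mu> \<nu> q1 q2 \<rho>s.
             dist_divergence I1 I2 l1 l2 \<phi> P \<le> divergence I1 I2 \<phi> (indep_prob I1 I2 l1 l2 P) a"
  shows "\<exists>(\<alpha> :: nat \<Rightarrow> nat \<Rightarrow> nat \<Rightarrow> real) (\<beta> :: nat \<Rightarrow> nat \<Rightarrow> nat \<Rightarrow> real) (\<psi> :: nat \<Rightarrow> real).
           \<forall>i\<in>{1..I1 - 1}. \<forall>j\<in>{1..I2 - 1}. \<forall>u\<in>{0, 1}. \<forall>v\<in>{0, 1}.
             let \<eta> = \<alpha> i j u + \<beta> i j v + (\<Sum>k\<in>{1..K}. \<psi> k * \<mu> k (i + u) * \<nu> k (j + v))
             in \<eta> \<in> F ` {0<..} \<and>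
                event_prob I1 I2 l1 l2 P i j u v =
                  row_prob I1 l1 P i u * col_prob I2 l2 P j v * the_inv_into {0<..} F \<eta>"
proof -
  define S where "S = {1..I1 - 1} \<times> {1..I2 - 1}"
  define p where "p = event_prob I1 I2 l1 l2 P"
  define r where "r = indep_prob I1 I2 l1 l2 P"
  define c where "c k = interaction (\<lambda>i j u v. \<mu> k (i + u) * \<nu> k (j + v))" for k
  define W where "W i j u v = F (p i j u v / r i j u v)" for i j u v
  let ?C = "system_class I1 I2 K \<mu> \<nu> q1 q2 \<rho>s"
  have P: "P \<in> table I1 I2" and p_class: "p \<in> ?C"
    using P_class by (auto simp: table_class_def p_def)
  have pos: "0 < p i j u v \<and> 0 < r i j u v"
    if "i \<in> {1..I1 - 1}" "j \<in> {1..I2 - 1}" "u \<in> {0, 1}" "v \<in> {0, 1}" for i j u v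
  proof -
    have p_pos: "0 < p i j u v"
      unfolding p_def event_prob_def
      using cut_event_nonempty[OF that(1)] cut_event_nonempty[OF that(2)]
        cut_event_subset[OF that(1)] cut_event_subset[OF that(2)] P_positive
      by (rule prob_rectangle_pos)
    \<comment> \<open>Each cell event lies inside its row and column events, so both factors of
      \<open>r\<close> are positive.\<close>
    have "p i j u v \<le> row_prob I1 l1 P i u" "p i j u v \<le> col_prob I2 l2 P j v"
      unfolding p_def event_prob_def row_prob_def col_prob_def
      by (auto intro!: measure_pmf.finite_measure_mono)
    with p_pos show ?thesis by (simp add: r_def indep_prob_def)
  qed
  have local_min: "\<forall>\<^sub>F t in nhds 0. divergence I1 I2 \<phi> r p \<le> divergence I1 I2 \<phi> r (shifted_system p \<delta> t)"
    if orth: "\<And>k. k \<in> {1..K} \<Longrightarrow> (\<Sum>z\<in>S. \<delta> z * c k z) = 0" for \<delta>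
  proof -
    have "\<forall>\<^sub>F t in nhds 0. \<forall>(i, j, u, v) \<in> {1..I1 - 1} \<times> {1..I2 - 1} \<times> {0, 1} \<times> {0, 1}.
        0 \<le> shifted_system p \<delta> t i j u v"
      unfolding shifted_system_def split_def
      by (rule eventually_nonneg_perturbation) (use pos in auto)
    then have in_class: "\<forall>\<^sub>F t in nhds 0. shifted_system p \<delta> t \<in> ?C"
      by (rule eventually_mono)
        (rule shifted_system_in_class[OF p_class], use orth in \<open>auto simp: S_def c_def\<close>)
    show ?thesis
    proof (cases "(l1 \<noteq> Global \<and> I1 > 2) \<or> (l2 \<noteq> Global \<and> I2 > 2)")
      case True
      show ?thesis
        using in_class
        by (rule eventually_mono)
          (use coherence_not_binding[OF True] in \<open>auto simp: dist_divergence_def p_def r_def\<close>)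
    next
      case False
      have supp: "{1..I1} \<times> {1..I2} \<subseteq> set_pmf P"
        using P_positive by (force simp: set_pmf_iff)
      from False have "l1 = Global \<or> \<not> I1 > 2" "l2 = Global \<or> \<not> I2 > 2" by auto
      \<comment> \<open>The table \<open>Q\<close> has the same independence system as
        \<open>P\<close>. Its own divergence is thus that of the shifted system against the fixed
        \<open>r\<close>, and minimality of \<open>P\<close> applies.\<close>
      note shifted_table_exists[OF P supp this, of \<delta>, folded p_def r_def]
      with in_class show ?thesis
      proof eventually_elim
        case (elim t)
        then obtain Q where Q: "Q \<in> table I1 I2"
          and agree: "\<And>i j u v. i \<in> {1..I1 - 1} \<Longrightarrow> j \<in> {1..I2 - 1} \<Longrightarrow> u \<in> {0, 1} \<Longrightarrow> v \<in> {0, 1} \<Longrightarrow>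
            event_prob I1 I2 l1 l2 Q i j u v = shifted_system p \<delta> t i j u v \<and>
            indep_prob I1 I2 l1 l2 Q i j u v = r i j u v"
          by blast
        have "event_prob I1 I2 l1 l2 Q \<in> ?C \<longleftrightarrow> shifted_system p \<delta> t \<in> ?C"
          by (rule system_class_cong) (use agree in blast)
        with elim Q have "Q \<in> table_class I1 I2 l1 l2 K \<mu> \<nu> q1 q2 \<rho>s"
          by (simp add: table_class_def)
        then have "divergence I1 I2 \<phi> r p \<le> dist_divergence I1 I2 l1 l2 \<phi> Q"
          using P_closest by (simp add: dist_divergence_def p_def r_def)
        also have "\<dots> = divergence I1 I2 \<phi> r (shifted_system p \<delta> t)"
          unfolding dist_divergence_def divergence_def
          by (rule system_sum_cong) (use agree in simp)
        finally show ?case .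
      qed
    qed
  qed
  have "\<exists>\<psi>. \<forall>z\<in>S. interaction W z = (\<Sum>k\<in>{1..K}. \<psi> k * c k z)"
  proof (rule mem_span_of_orthogonal_complement)
    fix \<delta> assume "\<And>k. k \<in> {1..K} \<Longrightarrow> (\<Sum>z\<in>S. \<delta> z * c k z) = 0"
    from local_min[OF this] obtain d where d: "0 < d"
      "\<And>t. \<bar>t\<bar> < d \<Longrightarrow> divergence I1 I2 \<phi> r p \<le> divergence I1 I2 \<phi> r (shifted_system p \<delta> t)"
      by (auto simp: eventually_nhds_metric dist_real_def)
    have shift_0: "shifted_system p \<delta> 0 = p" by (simp add: shifted_system_def)
    have "((\<lambda>t. divergence I1 I2 \<phi> r (shifted_system p \<delta> t)) has_real_derivative
        (\<Sum>z\<in>S. \<delta> z * interaction W z)) (at 0)"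
      unfolding S_def W_def using pos F_deriv by (rule divergence_shifted_system_deriv)
    \<comment> \<open>Small \<open>t\<close> of either sign are allowed, so \<open>t = 0\<close> is
      an interior minimum and the derivative vanishes.\<close>
    then show "(\<Sum>z\<in>S. \<delta> z * interaction W z) = 0"
      by (rule DERIV_local_min[OF _ d(1)]) (use d(2) in \<open>simp add: shift_0\<close>)
  qed (simp_all add: S_def)
  then obtain \<psi> where \<psi>: "\<And>i j. i \<in> {1..I1 - 1} \<Longrightarrow> j \<in> {1..I2 - 1} \<Longrightarrow>
      interaction W (i, j) = (\<Sum>k\<in>{1..K}. \<psi> k * c k (i, j))"
    unfolding S_def by blast
  define T where "T i j u v = (\<Sum>k\<in>{1..K}. \<psi> k * \<mu> k (i + u) * \<nu> k (j + v))" for i j u v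
  define R where "R i j u v = W i j u v - T i j u v" for i j u v
  \<comment> \<open>Zero interaction of \<open>R\<close> means that \<open>R i j u v\<close> equals
    \<open>R i j u 0 + R i j 0 v - R i j 0 0\<close>; the constant is put into
    \<open>\<beta>\<close>.\<close>
  define \<alpha> where "\<alpha> i j u = R i j u 0" for i j u
  define \<beta> where "\<beta> i j v = R i j 0 v - R i j 0 0" for i j v
  have split: "\<alpha> i j u + \<beta> i j v + T i j u v = W i j u v"
    if "i \<in> {1..I1 - 1}" "j \<in> {1..I2 - 1}" "u \<in> {0, 1}" "v \<in> {0, 1}" for i j u v
  proof -
    have "interaction T (i, j) = (\<Sum>k\<in>{1..K}. \<psi> k * c k (i, j))"
      by (simp add: T_def c_def interaction_def sum.distrib sum_subtractf algebra_simps)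
    with \<psi>[OF that(1,2)] have "interaction R (i, j) = 0"
      by (simp add: R_def interaction_def)
    then have "\<alpha> i j u + \<beta> i j v = R i j u v"
      using that(3,4) by (auto simp: \<alpha>_def \<beta>_def interaction_def)
    then show ?thesis by (simp add: R_def)
  qed
  show ?thesis
    unfolding Let_def
  proof (rule exI[of _ \<alpha>], rule exI[of _ \<beta>], rule exI[of _ \<psi>], intro ballI)
    fix i j u v :: nat
    assume ij: "i \<in> {1..I1 - 1}" "j \<in> {1..I2 - 1}" "u \<in> {0, 1}" "v \<in> {0, 1}"
    let ?\<eta> = "\<alpha> i j u + \<beta> i j v + (\<Sum>k\<in>{1..K}. \<psi> k * \<mu> k (i + u) * \<nu> k (j + v))"
    have eta: "?\<eta> = F (p i j u v / r i j u v)"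
      using split[OF ij] by (simp add: T_def W_def)
    \<comment> \<open>On this half-line \<open>F\<close> is injective, so its inverse recovers the
      quotient from \<open>?\<eta>\<close>.\<close>
    have quot: "p i j u v / r i j u v \<in> {0<..}" using pos[OF ij] by simp
    have "p i j u v = r i j u v * the_inv_into {0<..} F ?\<eta>"
      unfolding eta the_inv_into_f_f[OF F_inj quot] using pos[OF ij] by simp
    with eta quot show "?\<eta> \<in> F ` {0<..} \<and> event_prob I1 I2 l1 l2 P i j u v =
        row_prob I1 l1 P i u * col_prob I2 l2 P j v * the_inv_into {0<..} F ?\<eta>"
      by (simp add: p_def r_def indep_prob_def)
  qed
qed

end
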